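(* For any positive integer $j$ and for any graph $G=(V,E)$ with $n$ vertices, $m(G)$ edges and degree sequence $d_1\le d_2\le\dots\le d_n$, $$\gamma_j(G)\geq w^{\prime}_j(G)=\min\Big\{k\in\mathbb{Z},\ 0\le k\le n : \sum_{i=1}^k d_{n-i+1}+\frac12\sum_{i=k+1}^n(d_{n-i+1}-j)\geq m(G)\Big\}.$$
   Context: All graphs are simple and finite. A $j$-dominating set of $G=(V,E)$ is a set $D\subseteq V$ such that each vertex of $V-D$ has at least $j$ neighbors in $D$; $\gamma_j(G)$ is the cardinality of a smallest $j$-dominating set. *)

theory Defs
  imports Complex_Main "HOL-Library.Multiset"
begin

definition simple_graph :: "'a set \<Rightarrow> 'a set set \<Rightarrow> bool" where
  "simple_graph V E \<longleftrightarrow> finite V \<and> E \<subseteq> {e. e \<subseteq> V \<and> card e = 2}"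

definition neighbors :: "'a set set \<Rightarrow> 'a \<Rightarrow> 'a set" where
  "neighbors E v = {u. {v, u} \<in> E}"

definition degree :: "'a set set \<Rightarrow> 'a \<Rightarrow> nat" where
  "degree E v = card (neighbors E v)"

definition degree_list :: "'a set \<Rightarrow> 'a set set \<Rightarrow> nat list" where
  "degree_list V E = sorted_list_of_multiset (image_mset (degree E) (mset_set V))"

text \<open>The degree sequence \<open>d\<^sub>1 \<le> \<dots> \<le> d\<^sub>n\<close> is indexed from 1, so \<open>deg_seq V E i\<close> is
  meaningful only for \<open>1 \<le> i \<le> card V\<close>.\<close>

definition deg_seq :: "'a set \<Rightarrow> 'a set set \<Rightarrow> nat \<Rightarrow> nat" where
  "deg_seq V E i = degree_list V E ! (i - 1)"

definition dominating :: "nat \<Rightarrow> 'a set \<Rightarrow> 'a set set \<Rightarrow> 'a set \<Rightarrow> bool" where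
  "dominating j V E D \<longleftrightarrow> D \<subseteq> V \<and> (\<forall>v\<in>V - D. j \<le> card (neighbors E v \<inter> D))"

text \<open>The minimum is over a finite nonempty set when \<open>V\<close> is finite, since \<open>V\<close> dominates.\<close>

definition domination_number :: "nat \<Rightarrow> 'a set \<Rightarrow> 'a set set \<Rightarrow> nat" where
  "domination_number j V E = Min (card ` {D. dominating j V E D})"

text \<open>For a simple graph the minimum is over a nonempty set, since \<open>k = card V\<close> qualifies by the
  handshake identity. The summands \<open>d\<^sub>i - j\<close> may be negative, hence the
  subtraction is done in the reals.\<close>

definition w' :: "nat \<Rightarrow> 'a set \<Rightarrow> 'a set set \<Rightarrow> nat" where
  "w' j V E = (let n = card V; d = (\<lambda>i. real (deg_seq V E i)) in
     Min {k. k \<le> n \<and>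
       (\<Sum>i=1..k. d (n - i + 1)) + 1/2 * (\<Sum>i=k+1..n. d (n - i + 1) - real j) \<ge> real (card E)})"

end

theory Submission
  imports Defs
begin

text \<open>
  Write \<open>S k\<close> for the sum of the \<open>k\<close> largest degrees. By the handshake identity all the degrees
  add up to \<open>2 * card E\<close>, so the remaining \<open>n - k\<close> degrees sum to \<open>2 * card E - S k\<close>, and the
  inequality that defines \<open>w'\<close> collapses to \<open>S k \<ge> j * (n - k)\<close>.

  A \<open>j\<close>-dominating set \<open>D\<close> of size \<open>k\<close> satisfies this: each of the \<open>n - k\<close> vertices outside \<open>D\<close>
  sends at least \<open>j\<close> edges into \<open>D\<close>, while the degrees in \<open>D\<close> bound the number of edges leaving
  \<open>D\<close> from above (\<open>degree_sum_dominating\<close>); and the degrees in \<open>D\<close> sum to at most \<open>S k\<close>, because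
  no \<open>k\<close> entries of a list exceed its \<open>k\<close> largest (\<open>sum_mset_le_sum_list_drop\<close>). Hence the size of
  a smallest \<open>j\<close>-dominating set is among the candidates over which \<open>w'\<close> minimises.
\<close>

text \<open>
  Peeling the maximum \<open>x\<close> off the end of the list, an element to remove from \<open>A\<close> is \<open>x\<close> itself if
  it occurs there, and any element otherwise; either way what remains of \<open>A\<close> lies in the shorter
  list.
\<close>

lemma sum_mset_le_sum_list_drop:
  fixes xs :: "'b :: {linorder, ordered_comm_monoid_add} list"
  assumes "sorted xs" and "A \<subseteq># mset xs"
  shows "sum_mset A \<le> sum_list (drop (length xs - size A) xs)"
  using assms
proof (induction xs arbitrary: A rule: rev_induct)
  case Nil
  then show ?case by simp
next
  case (snoc x xs)
  show ?case
  proof (cases "A = {#}")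
    case True
    then show ?thesis by simp
  next
    case False
    have "\<exists>a \<in># A. x \<in># A \<longrightarrow> a = x"
      using False by (cases "x \<in># A") (auto simp: multiset_nonemptyE)
    then obtain a where a: "a \<in># A" "x \<in># A \<longrightarrow> a = x" by blast
    have "a \<in># mset (xs @ [x])"
      using a(1) snoc.prems(2) by (rule mset_subset_eqD[rotated])
    then have "a \<le> x"
      using snoc.prems(1) by (auto simp: sorted_append)
    obtain B where B: "A = add_mset a B"
      using a(1) by (metis mset_add)
    have "B \<subseteq># mset xs"
    proof (cases "x \<in># A")
      case True
      then show ?thesis using B a(2) snoc.prems(2) by simp
    next
      case False
      have "A \<subseteq># mset xs"
      proof (rule mset_subset_eqI)
        fix y
        have "count A y \<le> count (mset (xs @ [x])) y"
          using snoc.prems(2) by (rule mset_subset_eq_count)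
        then show "count A y \<le> count (mset xs) y"
          using False by (cases "y = x") (auto simp: not_in_iff)
      qed
      then show ?thesis using B by (meson mset_subset_eq_insertD subset_mset.less_imp_le)
    qed
    moreover have "sorted xs" using snoc.prems(1) by (simp add: sorted_append)
    ultimately have "sum_mset B \<le> sum_list (drop (length xs - size B) xs)"
      by (intro snoc.IH)
    then show ?thesis
      using \<open>a \<le> x\<close> B by (simp add: add.commute[of a] add_mono)
  qed
qed

lemma sum_nth_from_end:
  fixes xs :: "'b :: comm_monoid_add list"
  assumes "k \<le> length xs"
  shows "(\<Sum>i=1..k. xs ! (length xs - i)) = sum_list (drop (length xs - k) xs)"
proof -
  have "(\<Sum>i=1..k. xs ! (length xs - i)) = (\<Sum>i=length xs - k..<length xs. xs ! i)"
    using assms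
    by (intro sum.reindex_bij_witness[of _ "\<lambda>i. length xs - i" "\<lambda>i. length xs - i"]) auto
  also have "\<dots> = sum_list (drop (length xs - k) xs)"
    using assms sum.shift_bounds_nat_ivl[of "(!) xs" 0 "length xs - k" k]
    by (auto simp: sum_list_sum_nth add.commute intro!: sum.cong)
  finally show ?thesis .
qed

lemma neighbors_sym: "u \<in> neighbors E v \<longleftrightarrow> v \<in> neighbors E u"
  by (simp add: neighbors_def insert_commute)

lemma neighbors_subset:
  assumes "simple_graph V E"
  shows "neighbors E v \<subseteq> V - {v}"
  using assms unfolding simple_graph_def neighbors_def by fastforce

lemma finite_neighbors:
  assumes "simple_graph V E"
  shows "finite (neighbors E v)"
  using neighbors_subset[OF assms] assms unfolding simple_graph_def
  by (meson finite_Diff finite_subset)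

lemma degree_eq_card_incident_edges:
  assumes "simple_graph V E"
  shows "degree E v = card {e \<in> E. v \<in> e}"
proof -
  have "inj_on (\<lambda>u. {v, u}) (neighbors E v)"
    by (auto simp: inj_on_def doubleton_eq_iff)
  moreover have "(\<lambda>u. {v, u}) ` neighbors E v = {e \<in> E. v \<in> e}"
  proof (intro equalityI subsetI)
    fix e assume e: "e \<in> {e \<in> E. v \<in> e}"
    then have "card e = 2" using assms unfolding simple_graph_def by blast
    then obtain u where "e = {v, u}"
      using e by (auto simp: card_2_iff)
    then show "e \<in> (\<lambda>u. {v, u}) ` neighbors E v"
      using e by (auto simp: neighbors_def)
  qed (auto simp: neighbors_def)
  ultimately show ?thesis
    unfolding degree_def by (metis card_image)
qed

lemma handshake:
  assumes "simple_graph V E"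
  shows "(\<Sum>v\<in>V. degree E v) = 2 * card E"
proof -
  have finV: "finite V" and E: "E \<subseteq> {e. e \<subseteq> V \<and> card e = 2}"
    using assms unfolding simple_graph_def by auto
  have finE: "finite E"
    using E finV by (auto intro: finite_subset[of _ "Pow V"])
  have "card {v \<in> V. v \<in> e} = 2" if "e \<in> E" for e
  proof -
    have "{v \<in> V. v \<in> e} = e" using that E by auto
    then show ?thesis using that E by auto
  qed
  then have "(\<Sum>v\<in>V. card {e \<in> E. v \<in> e}) = 2 * card E"
    using finV finE by (intro sum_multicount) auto
  then show ?thesis by (simp add: degree_eq_card_incident_edges[OF assms])
qed

text \<open>Both sides count the edges between \<open>A\<close> and \<open>B\<close>, from either end.\<close>

lemma card_crossing_edges_sym:
  assumes "finite A" "finite B"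
  shows "(\<Sum>v\<in>A. card (neighbors E v \<inter> B)) = (\<Sum>v\<in>B. card (neighbors E v \<inter> A))"
proof -
  have *: "neighbors E v \<inter> B = {u \<in> B. u \<in> neighbors E v}"
    "neighbors E v \<inter> A = {u \<in> A. v \<in> neighbors E u}" for v
    by (auto simp: neighbors_sym[of _ E v])
  show ?thesis
    unfolding * using assms by (intro sum_multicount_gen) auto
qed

text \<open>
  The number of edges between \<open>D\<close> and its complement lies between the two sides: every outer vertex
  has \<open>j\<close> of them, and a vertex of \<open>D\<close> has no more of them than its degree.
\<close>

lemma degree_sum_dominating:
  assumes "simple_graph V E" and "dominating j V E D"
  shows "j * (card V - card D) \<le> (\<Sum>v\<in>D. degree E v)"
proof -
  have fin: "finite V" "finite D" and "D \<subseteq> V"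
    using assms unfolding simple_graph_def dominating_def by (auto intro: finite_subset)
  have "j * (card V - card D) = (\<Sum>v\<in>V - D. j)"
    using \<open>finite D\<close> \<open>D \<subseteq> V\<close> by (simp add: card_Diff_subset)
  also have "\<dots> \<le> (\<Sum>v\<in>V - D. card (neighbors E v \<inter> D))"
    using assms(2) unfolding dominating_def by (intro sum_mono) auto
  also have "\<dots> = (\<Sum>v\<in>D. card (neighbors E v \<inter> (V - D)))"
    using fin by (intro card_crossing_edges_sym) auto
  also have "\<dots> \<le> (\<Sum>v\<in>D. degree E v)"
    unfolding degree_def
    by (intro sum_mono card_mono finite_neighbors[OF assms(1)]) auto
  finally show ?thesis .
qed

lemma mset_degree_list: "mset (degree_list V E) = image_mset (degree E) (mset_set V)"
  by (simp add: degree_list_def)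

lemma length_degree_list: "length (degree_list V E) = card V"
  by (metis mset_degree_list size_image_mset size_mset size_mset_set)

lemma sum_list_degree_list: "sum_list (degree_list V E) = (\<Sum>v\<in>V. degree E v)"
  by (metis mset_degree_list sum_mset_sum_list sum_unfold_sum_mset)

lemma degree_sum_le_largest_degrees:
  assumes "finite V" and "D \<subseteq> V"
  shows "(\<Sum>v\<in>D. degree E v) \<le> (\<Sum>i=1..card D. deg_seq V E (card V - i + 1))"
proof -
  let ?A = "image_mset (degree E) (mset_set D)"
  have "?A \<subseteq># mset (degree_list V E)"
    unfolding mset_degree_list using assms
    by (intro image_mset_subseteq_mono subset_imp_msubset_mset_set)
  then have "sum_mset ?A \<le> sum_list (drop (card V - card D) (degree_list V E))"
    using sum_mset_le_sum_list_drop[of "degree_list V E" ?A]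
    by (simp add: length_degree_list) (simp add: degree_list_def)
  also have "\<dots> = (\<Sum>i=1..card D. deg_seq V E (card V - i + 1))"
    using sum_nth_from_end[of "card D" "degree_list V E"] card_mono[OF assms]
    by (simp add: deg_seq_def length_degree_list)
  finally show ?thesis by (simp add: sum_unfold_sum_mset)
qed

lemma sum_deg_seq:
  assumes "simple_graph V E"
  shows "(\<Sum>i=1..card V. deg_seq V E (card V - i + 1)) = 2 * card E"
  using sum_nth_from_end[of "card V" "degree_list V E"] handshake[OF assms]
  by (simp add: deg_seq_def length_degree_list sum_list_degree_list)

text \<open>
  The inequality that defines \<open>w'\<close>, freed of the edge count by eliminating the small degrees with
  the handshake identity.
\<close>

lemma w'_condition_iff:
  fixes V :: "'a set" and E :: "'a set set" and j k :: nat
  defines "d \<equiv> \<lambda>i. deg_seq V E (card V - i + 1)"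
  assumes "simple_graph V E" and "k \<le> card V"
  shows "(\<Sum>i=1..k. real (d i)) + 1/2 * (\<Sum>i=k+1..card V. real (d i) - real j) \<ge> real (card E)
    \<longleftrightarrow> j * (card V - k) \<le> (\<Sum>i=1..k. d i)"
proof -
  have "(\<Sum>i=1..card V. d i) = (\<Sum>i=1..k. d i) + (\<Sum>i=k+1..card V. d i)"
    using sum.ub_add_nat[of 1 k d "card V - k"] assms(3) by simp
  then have "2 * card E = (\<Sum>i=1..k. d i) + (\<Sum>i=k+1..card V. d i)"
    using sum_deg_seq[OF assms(2)] by (simp add: d_def)
  then have "2 * real (card E) = (\<Sum>i=1..k. real (d i)) + (\<Sum>i=k+1..card V. real (d i))"
    by (simp flip: of_nat_sum of_nat_add of_nat_mult)
  moreover have "(\<Sum>i=k+1..card V. real (d i) - real j)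
      = (\<Sum>i=k+1..card V. real (d i)) - real (j * (card V - k))"
    by (simp add: sum_subtractf)
  moreover have "j * (card V - k) \<le> (\<Sum>i=1..k. d i)
      \<longleftrightarrow> real (j * (card V - k)) \<le> (\<Sum>i=1..k. real (d i))"
    by (simp only: of_nat_le_iff flip: of_nat_sum)
  ultimately show ?thesis by argo
qed

lemma w'_le_card_dominating:
  assumes "simple_graph V E" and "dominating j V E D"
  shows "w' j V E \<le> card D"
proof -
  have "finite V" "D \<subseteq> V"
    using assms unfolding simple_graph_def dominating_def by auto
  then have "card D \<le> card V"
    by (rule card_mono)
  moreover have "j * (card V - card D) \<le> (\<Sum>i=1..card D. deg_seq V E (card V - i + 1))"
    using degree_sum_dominating[OF assms]
      degree_sum_le_largest_degrees[OF \<open>finite V\<close> \<open>D \<subseteq> V\<close>, of E] by linarith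
  ultimately show ?thesis
    unfolding w'_def Let_def
    using w'_condition_iff[OF assms(1), of "card D" j] by (intro Min_le) auto
qed

lemma domination_number_attained:
  assumes "finite V"
  obtains D where "dominating j V E D" and "card D = domination_number j V E"
proof -
  have "dominating j V E V"
    by (simp add: dominating_def)
  moreover have "finite {D. dominating j V E D}"
    using assms by (rule finite_subset[rotated, OF finite_Pow_iff[THEN iffD2]])
      (auto simp: dominating_def)
  ultimately have "domination_number j V E \<in> card ` {D. dominating j V E D}"
    unfolding domination_number_def by (intro Min_in) auto
  then show ?thesis using that by auto
qed

theorem theorem5p3:
  fixes V :: "'a set" and E :: "'a set set" and j :: nat
  assumes "simple_graph V E" and "j \<ge> 1"
  shows "domination_number j V E \<ge> w' j V E"
  using assms(1) w'_le_card_dominating domination_number_attained[of V j E]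
  unfolding simple_graph_def by metis

end
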